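(* Let $Y$ be a Banach space, let $A:\ell^1(\mathbb{N})\to Y$ be an injective bounded linear operator, and let $x^\dagger\in\ell^1(\mathbb{N})$. Let $(\mathcal{M}_n)_{n\in\mathbb{N}}$ be a sequence of families of index sets, $(\gamma_n)_{n\in\mathbb{N}}$ a sequence of positive real numbers and $c\in[0,1)$ such that the Source Assumption (defined in the context) holds for $A$ with $(\mathcal{M}_n)$, $(\gamma_n)$ and $c$. Assume further that there is some $k\in\mathbb{N}$ with $\gamma_k<\inf_{l>k}\gamma_l$. Define $$\varphi(t):=2\inf_{n\in\mathbb{N}}\left(\inf_{M\in\mathcal{M}_n}\|(I-P_M)x^\dagger\|_{\ell^1(\mathbb{N})}+\frac{1}{1+c}\,\gamma_n\,t\right),\qquad t\in[0,\infty),$$ and $\beta:=\frac{1-c}{1+c}$. Then $\varphi:[0,\infty)\to[0,\infty)$ is a concave index function, and $$\beta\|x-x^\dagger\|_{\ell^1(\mathbb{N})}\leq\|x\|_{\ell^1(\mathbb{N})}-\|x^\dagger\|_{\ell^1(\mathbb{N})}+\varphi(\|Ax-Ax^\dagger\|_Y)\quad\text{for all }x\in\ell^1(\mathbb{N}).$$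
   Context: Sequences are real and indexed by $\mathbb{N}=\{1,2,\ldots\}$. $A^\ast:Y^\ast\to\ell^\infty(\mathbb{N})$ is the adjoint of $A$, where $\ell^\infty(\mathbb{N})$ is identified with the dual of $\ell^1(\mathbb{N})$. Index function: a function $\varphi:[0,\infty)\to[0,\infty)$ that is continuous and strictly increasing with $\varphi(0)=0$. For $M\subseteq\mathbb{N}$, $P_M$ denotes the projection (on $\ell^\infty(\mathbb{N})$ and on $\ell^1(\mathbb{N})$) given by $[P_M\xi]_k=\xi_k$ if $k\in M$ and $[P_M\xi]_k=0$ otherwise; $I$ is the identity. $\supp\xi=\{k\in\mathbb{N}:\xi_k\neq0\}$. Let $$\mathbf{1}_M:=\{\xi\in\ell^\infty(\mathbb{N}):\supp\xi\subseteq M\text{ and }\xi_k\in\{-1,0,1\}\text{ for all }k\in\mathbb{N}\}.$$ Source Assumption (for $A$, with $(\mathcal{M}_n)_{n\in\mathbb{N}}$, constants $\gamma_n>0$ and $c\in[0,1)$): for each $n\in\mathbb{N}$, $\mathcal{M}_n$ is a family of index sets $M\subseteq\mathbb{N}$ of cardinality $|M|=n$ with $\{1,\ldots,n\}\in\mathcal{M}_n$; and for each $n\in\mathbb{N}$ and each $\xi\in\bigcup_{M\in\mathcal{M}_n}\mathbf{1}_M$ there is some $\eta=\eta(n,\xi)\in Y^\ast$ such that (i) $\|\eta\|_{Y^\ast}\leq\gamma_n$ (with $\gamma_n$ independent of $\xi$); (ii) $P_{\supp\xi}A^\ast\eta=\xi$; (iii) $\|(I-P_{\supp\xi})A^\ast\eta\|_{\ell^\infty(\mathbb{N})}\leq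 c$ (with $c$ independent of $\xi$ and $n$). *)

theory Defs
  imports "HOL-Analysis.Analysis"
begin

section \<open>The spaces of absolutely summable and of bounded sequences\<close>

text \<open>
  Sequences $(x_1, x_2, \dots)$ are represented by functions on \<^typ>\<open>nat\<close> whose value at \<open>k\<close> is the
  coordinate $x_{k+1}$. Hence an index set $M \subseteq \{1, 2, \dots\}$ becomes the set
  $\{m - 1 : m \in M\}$, and $\{1, \dots, n\}$ becomes \<open>{..<n}\<close>. Cardinalities \<open>n\<close> (and the
  constants and families indexed by them) are not shifted and always range over \<open>n \<ge> 1\<close>.
\<close>

typedef l1 = "{x :: nat \<Rightarrow> real. summable (\<lambda>k. \<bar>x k\<bar>)}"
  morphisms l1_nth Abs_l1
  by (rule exI[of _ "\<lambda>_. 0"]) simp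

setup_lifting type_definition_l1

lemma l1_eqI: "(\<And>k. l1_nth x k = l1_nth y k) \<Longrightarrow> x = y"
  by transfer auto

lemma summable_l1_abs: "summable (\<lambda>k. \<bar>l1_nth x k\<bar>)"
  using l1_nth[of x] by simp

lemma summable_abs_add:
  fixes x y :: "nat \<Rightarrow> real"
  assumes "summable (\<lambda>k. \<bar>x k\<bar>)" "summable (\<lambda>k. \<bar>y k\<bar>)"
  shows "summable (\<lambda>k. \<bar>x k + y k\<bar>)"
  by (rule summable_comparison_test'[OF summable_add[OF assms], of 0]) simp

instantiation l1 :: real_normed_vector
begin

lift_definition zero_l1 :: l1 is "\<lambda>_. 0" by simp
lift_definition plus_l1 :: "l1 \<Rightarrow> l1 \<Rightarrow> l1" is "\<lambda>x y k. x k + y k"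
  by (rule summable_abs_add)
lift_definition uminus_l1 :: "l1 \<Rightarrow> l1" is "\<lambda>x k. - x k" by simp
lift_definition minus_l1 :: "l1 \<Rightarrow> l1 \<Rightarrow> l1" is "\<lambda>x y k. x k - y k"
  using summable_abs_add[where y = "\<lambda>k. - (z k)" for z] by simp
lift_definition scaleR_l1 :: "real \<Rightarrow> l1 \<Rightarrow> l1" is "\<lambda>r x k. r * x k"
  by (simp add: abs_mult summable_mult)
lift_definition norm_l1 :: "l1 \<Rightarrow> real" is "\<lambda>x. \<Sum>k. \<bar>x k\<bar>" .

definition sgn_l1 :: "l1 \<Rightarrow> l1" where "sgn_l1 x = scaleR (inverse (norm x)) x"
definition dist_l1 :: "l1 \<Rightarrow> l1 \<Rightarrow> real" where "dist_l1 x y = norm (x - y)"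
definition uniformity_l1 :: "(l1 \<times> l1) filter"
  where "uniformity_l1 = (INF e\<in>{0<..}. principal {(x, y). dist x y < e})"
definition open_l1 :: "l1 set \<Rightarrow> bool"
  where "open_l1 U = (\<forall>x\<in>U. eventually (\<lambda>(x', y). x' = x \<longrightarrow> y \<in> U) uniformity)"

instance
proof
  fix a b :: real and x y z :: l1 and U :: "l1 set"
  show "x + y + z = x + (y + z)" by transfer (simp add: algebra_simps)
  show "x + y = y + x" by transfer (simp add: algebra_simps)
  show "0 + x = x" by transfer simp
  show "- x + x = 0" by transfer simp
  show "x - y = x + - y" by transfer simp
  show "a *\<^sub>R (x + y) = a *\<^sub>R x + a *\<^sub>R y" by transfer (simp add: algebra_simps)
  show "(a + b) *\<^sub>R x = a *\<^sub>R x + b *\<^sub>R x" by transfer (simp add: algebra_simps)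
  show "a *\<^sub>R b *\<^sub>R x = (a * b) *\<^sub>R x" by transfer (simp add: algebra_simps)
  show "1 *\<^sub>R x = x" by transfer simp
  show "sgn x = inverse (norm x) *\<^sub>R x" by (rule sgn_l1_def)
  show "dist x y = norm (x - y)" by (rule dist_l1_def)
  show "uniformity = (INF e\<in>{0<..}. principal {(x :: l1, y). dist x y < e})"
    by (rule uniformity_l1_def)
  show "open U = (\<forall>x\<in>U. \<forall>\<^sub>F (x', y) in uniformity. x' = x \<longrightarrow> y \<in> U)"
    by (rule open_l1_def)
  show "norm x = 0 \<longleftrightarrow> x = 0"
    by transfer (auto simp: suminf_eq_zero_iff fun_eq_iff)
  show "norm (x + y) \<le> norm x + norm y"
  proof transfer
    fix x y :: "nat \<Rightarrow> real"
    assume *: "summable (\<lambda>k. \<bar>x k\<bar>)" "summable (\<lambda>k. \<bar>y k\<bar>)"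
    have "(\<Sum>k. \<bar>x k + y k\<bar>) \<le> (\<Sum>k. \<bar>x k\<bar> + \<bar>y k\<bar>)"
      by (intro suminf_le summable_abs_add summable_add * abs_triangle_ineq)
    then show "(\<Sum>k. \<bar>x k + y k\<bar>) \<le> (\<Sum>k. \<bar>x k\<bar>) + (\<Sum>k. \<bar>y k\<bar>)"
      using suminf_add[OF *] by simp
  qed
  show "norm (a *\<^sub>R x) = \<bar>a\<bar> * norm x"
    by transfer (simp add: abs_mult suminf_mult)
qed

end

text \<open>As \<^typ>\<open>nat\<close> is discrete, the bounded continuous functions on it, with the supremum norm, are
  all of $\ell^\infty$.\<close>

type_synonym linf = "nat \<Rightarrow>\<^sub>C real"

lemma bcontfun_nat_iff: "f \<in> bcontfun \<longleftrightarrow> bounded (range f)" for f :: "nat \<Rightarrow> real"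
  by (simp add: bcontfun_def)

section \<open>Coordinate projections and sign sequences\<close>

definition supp :: "linf \<Rightarrow> nat set"
  where "supp \<xi> = {k. apply_bcontfun \<xi> k \<noteq> 0}"

lift_definition proj_l1 :: "nat set \<Rightarrow> l1 \<Rightarrow> l1" is "\<lambda>M x k. if k \<in> M then x k else 0"
  by (erule summable_comparison_test'[where N = 0]) simp

definition proj_linf :: "nat set \<Rightarrow> linf \<Rightarrow> linf"
  where "proj_linf M \<xi> = Bcontfun (\<lambda>k. if k \<in> M then apply_bcontfun \<xi> k else 0)"

lemma apply_proj_linf: "apply_bcontfun (proj_linf M \<xi>) k = (if k \<in> M then apply_bcontfun \<xi> k else 0)"
proof -
  have "norm (if k \<in> M then apply_bcontfun \<xi> k else 0) \<le> norm \<xi>" for k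
    using norm_bounded[of \<xi> k] by simp
  then have "(\<lambda>k. if k \<in> M then apply_bcontfun \<xi> k else 0) \<in> bcontfun"
    unfolding bcontfun_nat_iff bounded_iff by blast
  then show ?thesis
    by (simp add: proj_linf_def Bcontfun_inverse)
qed

definition sign_seqs :: "nat set \<Rightarrow> linf set"
  where "sign_seqs M = {\<xi>. supp \<xi> \<subseteq> M \<and> (\<forall>k. apply_bcontfun \<xi> k \<in> {-1, 0, 1})}"

section \<open>Bounded sequences as the dual of the summable ones, and the adjoint\<close>

lemma l1_pairing:
  fixes \<xi> :: linf and x :: l1
  shows summable_abs_l1_pairing: "summable (\<lambda>k. \<bar>apply_bcontfun \<xi> k * l1_nth x k\<bar>)"
    and summable_l1_pairing: "summable (\<lambda>k. apply_bcontfun \<xi> k * l1_nth x k)"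
    and abs_l1_pairing_le: "\<bar>\<Sum>k. apply_bcontfun \<xi> k * l1_nth x k\<bar> \<le> norm x * norm \<xi>"
proof -
  have le: "\<bar>apply_bcontfun \<xi> k * l1_nth x k\<bar> \<le> norm \<xi> * \<bar>l1_nth x k\<bar>" for k
    using norm_bounded[of \<xi> k] by (simp add: abs_mult mult_right_mono)
  have s: "summable (\<lambda>k. norm \<xi> * \<bar>l1_nth x k\<bar>)"
    by (intro summable_mult summable_l1_abs)
  show 1: "summable (\<lambda>k. \<bar>apply_bcontfun \<xi> k * l1_nth x k\<bar>)"
    by (rule summable_comparison_test'[OF s, of 0]) (use le in simp)
  then show "summable (\<lambda>k. apply_bcontfun \<xi> k * l1_nth x k)"
    by (rule summable_rabs_cancel)
  have "\<bar>\<Sum>k. apply_bcontfun \<xi> k * l1_nth x k\<bar> \<le> (\<Sum>k. norm \<xi> * \<bar>l1_nth x k\<bar>)"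
    by (rule order_trans[OF summable_rabs[OF 1] suminf_le[OF le 1 s]])
  also have "\<dots> = norm x * norm \<xi>"
    by (simp add: suminf_mult summable_l1_abs norm_l1.rep_eq mult.commute)
  finally show "\<bar>\<Sum>k. apply_bcontfun \<xi> k * l1_nth x k\<bar> \<le> norm x * norm \<xi>" .
qed

definition linf_dual :: "linf \<Rightarrow> l1 \<Rightarrow>\<^sub>L real"
  where "linf_dual \<xi> = Blinfun (\<lambda>x. \<Sum>k. apply_bcontfun \<xi> k * l1_nth x k)"

lemma linf_dual_apply: "blinfun_apply (linf_dual \<xi>) x = (\<Sum>k. apply_bcontfun \<xi> k * l1_nth x k)"
proof -
  have "bounded_linear (\<lambda>x. \<Sum>k. apply_bcontfun \<xi> k * l1_nth x k)"
    by (rule bounded_linear_intro[OF _ _ abs_l1_pairing_le[folded real_norm_def]])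
       (simp_all add: plus_l1.rep_eq scaleR_l1.rep_eq distrib_left suminf_add summable_l1_pairing
         mult.left_commute suminf_mult)
  then show ?thesis
    by (simp add: linf_dual_def bounded_linear_Blinfun_apply)
qed

lift_definition unit_l1 :: "nat \<Rightarrow> l1" is "\<lambda>j k. if k = j then 1 else 0"
  by (rule summable_finite[of "{j}" for j]) auto

lemma norm_unit_l1 [simp]: "norm (unit_l1 j) = 1"
  by transfer (subst suminf_finite[of "{j}" for j], auto)

lemma linf_dual_unit [simp]: "linf_dual \<xi> (unit_l1 j) = apply_bcontfun \<xi> j"
  by (simp add: linf_dual_apply unit_l1.rep_eq, subst suminf_finite[of "{j}"], auto)

lemma l1_sums_unit: "(\<lambda>k. l1_nth x k *\<^sub>R unit_l1 k) sums x"
  unfolding sums_def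
proof (rule metric_LIMSEQ_I)
  fix r :: real assume "0 < r"
  have nth: "l1_nth (\<Sum>k<n. l1_nth x k *\<^sub>R unit_l1 k) j = (if j < n then l1_nth x j else 0)" for n j
    by (induction n) (auto simp: zero_l1.rep_eq plus_l1.rep_eq scaleR_l1.rep_eq unit_l1.rep_eq
        less_Suc_eq)
  have d: "dist (\<Sum>k<n. l1_nth x k *\<^sub>R unit_l1 k) x = (\<Sum>k. \<bar>l1_nth x (k + n)\<bar>)" for n
  proof -
    let ?f = "\<lambda>k. \<bar>l1_nth ((\<Sum>k<n. l1_nth x k *\<^sub>R unit_l1 k) - x) k\<bar>"
    have "suminf ?f = (\<Sum>k. ?f (k + n)) + sum ?f {..<n}"
      by (rule suminf_split_initial_segment[OF summable_l1_abs])
    then show ?thesis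
      by (simp add: dist_norm norm_l1.rep_eq minus_l1.rep_eq nth)
  qed
  show "\<exists>N. \<forall>n\<ge>N. dist (\<Sum>k<n. l1_nth x k *\<^sub>R unit_l1 k) x < r"
    using suminf_exist_split[OF \<open>0 < r\<close> summable_l1_abs[of x]] unfolding d
    by (metis abs_ge_self order.strict_trans1 real_norm_def)
qed

lemma bij_linf_dual: "bij linf_dual"
proof (rule bijI)
  show "inj linf_dual"
    by (rule injI, rule bcontfun_eqI) (metis linf_dual_unit)
  show "surj linf_dual"
  proof (rule surjI[of _ "\<lambda>f. Bcontfun (\<lambda>k. blinfun_apply f (unit_l1 k))"], rule blinfun_eqI)
    fix f :: "l1 \<Rightarrow>\<^sub>L real" and x
    have "\<bar>blinfun_apply f (unit_l1 k)\<bar> \<le> norm f" for k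
      using norm_blinfun[of f "unit_l1 k"] by simp
    then have "(\<lambda>k. blinfun_apply f (unit_l1 k)) \<in> bcontfun"
      by (auto simp: bcontfun_nat_iff bounded_iff)
    moreover have "(\<lambda>k. blinfun_apply f (l1_nth x k *\<^sub>R unit_l1 k)) sums blinfun_apply f x"
      by (rule bounded_linear.sums[OF blinfun.bounded_linear_right l1_sums_unit])
    ultimately show "linf_dual (Bcontfun (\<lambda>k. blinfun_apply f (unit_l1 k))) x = blinfun_apply f x"
      by (simp add: linf_dual_apply Bcontfun_inverse blinfun.scaleR_right mult.commute sums_iff)
  qed
qed

lemma norm_linf_dual: "norm (linf_dual \<xi>) = norm \<xi>"
proof (rule antisym)
  show "norm (linf_dual \<xi>) \<le> norm \<xi>"
    by (rule norm_blinfun_bound)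
       (use abs_l1_pairing_le[of \<xi>] in \<open>auto simp: linf_dual_apply mult.commute\<close>)
  show "norm \<xi> \<le> norm (linf_dual \<xi>)"
    by (rule norm_bound) (use norm_blinfun[of "linf_dual \<xi>" "unit_l1 k" for k] in simp)
qed

text \<open>\<open>\<eta> o\<^sub>L A\<close> is the Banach space adjoint of \<open>A\<close> applied to \<open>\<eta>\<close>; the dual of $\ell^1$ is identified
  with $\ell^\infty$ through the isometric bijection \<^const>\<open>linf_dual\<close>.\<close>

definition adjoint_l1 :: "(l1 \<Rightarrow>\<^sub>L 'y::real_normed_vector) \<Rightarrow> ('y \<Rightarrow>\<^sub>L real) \<Rightarrow> linf"
  where "adjoint_l1 A \<eta> = inv linf_dual (\<eta> o\<^sub>L A)"

lemma linf_dual_adjoint_l1: "linf_dual (adjoint_l1 A \<eta>) = \<eta> o\<^sub>L A"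
  unfolding adjoint_l1_def by (rule surj_f_inv_f[OF bij_is_surj[OF bij_linf_dual]])

section \<open>Index functions, the source assumption and the rate function\<close>

definition index_function :: "(real \<Rightarrow> real) \<Rightarrow> bool"
  where "index_function \<phi> \<longleftrightarrow>
    (\<forall>t\<ge>0. 0 \<le> \<phi> t) \<and> continuous_on {0..} \<phi> \<and> strict_mono_on {0..} \<phi> \<and> \<phi> 0 = 0"

definition source_assumption ::
  "(l1 \<Rightarrow>\<^sub>L 'y::real_normed_vector) \<Rightarrow> (nat \<Rightarrow> nat set set) \<Rightarrow> (nat \<Rightarrow> real) \<Rightarrow> real \<Rightarrow> bool"
  where "source_assumption A \<M> \<gamma> c \<longleftrightarrow>
    (\<forall>n\<ge>1. (\<forall>M\<in>\<M> n. finite M \<and> card M = n) \<and> {..<n} \<in> \<M> n) \<and>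
    (\<forall>n\<ge>1. \<forall>\<xi>\<in>(\<Union>M\<in>\<M> n. sign_seqs M). \<exists>\<eta> :: 'y \<Rightarrow>\<^sub>L real.
       norm \<eta> \<le> \<gamma> n \<and>
       proj_linf (supp \<xi>) (adjoint_l1 A \<eta>) = \<xi> \<and>
       norm (adjoint_l1 A \<eta> - proj_linf (supp \<xi>) (adjoint_l1 A \<eta>)) \<le> c)"

definition rate_function ::
  "(nat \<Rightarrow> nat set set) \<Rightarrow> (nat \<Rightarrow> real) \<Rightarrow> real \<Rightarrow> l1 \<Rightarrow> real \<Rightarrow> real"
  where "rate_function \<M> \<gamma> c x\<^sub>0 t =
    2 * (INF n\<in>{1..}. (INF M\<in>\<M> n. norm (x\<^sub>0 - proj_l1 M x\<^sub>0)) + 1 / (1 + c) * \<gamma> n * t)"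

end

theory Submission
  imports Defs
begin

text \<open>
  Fix an index set \<open>M\<close> in the \<open>n\<close>-th family, put \<open>h = x - x\<^sub>0\<close>, and let \<open>\<eta>\<close> be the source element for
  the signs of \<open>h\<close> on \<open>M\<close>. Pairing \<open>h\<close> with $A^* \eta$ gives
  $\|P_M h\| \le c \, \|(I - P_M) h\| + \gamma_n \|A h\|$. The triangle inequality, applied separately
  on and off \<open>M\<close>, gives
  $\|x\| - \|x_0\| \ge \|(I - P_M) h\| - \|P_M h\| - 2 \|(I - P_M) x_0\|$. Eliminating
  $\|P_M h\|$ and taking infima over \<open>M\<close> and \<open>n\<close> yields the variational inequality.

  The rate function is an infimum of affine functions, hence concave. It vanishes at \<open>0\<close> because the
  tails of \<open>x\<^sub>0\<close> tend to \<open>0\<close>, and it is strictly increasing because the condition on \<open>\<gamma>\<close> keeps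
  the slopes of these affine functions away from \<open>0\<close>.
\<close>

section \<open>Infima of affine functions\<close>

text \<open>A real infimum has its usual properties only on sets bounded below. Nonnegative
  intercepts and slopes provide the bound 0, but only for \<open>t\<close> in the half-line.\<close>

lemma bdd_below_affine:
  fixes a g :: "'i \<Rightarrow> real"
  assumes "\<And>i. i \<in> I \<Longrightarrow> 0 \<le> a i" "\<And>i. i \<in> I \<Longrightarrow> 0 \<le> g i" "0 \<le> t"
  shows "bdd_below ((\<lambda>i. a i + g i * t) ` I)"
  by (rule bdd_belowI2[of _ 0]) (simp add: assms)

text \<open>Each affine member turns the convex combination into an equality, so the combination of
  infima lies below every member and hence below their infimum.\<close>

lemma concave_on_INF_affine:
  fixes a g :: "'i \<Rightarrow> real"
  assumes "I \<noteq> {}" "\<And>i. i \<in> I \<Longrightarrow> 0 \<le> a i" "\<And>i. i \<in> I \<Longrightarrow> 0 \<le> g i"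
  shows "concave_on {0..} (\<lambda>t. INF i\<in>I. a i + g i * t)"
  unfolding concave_on_iff
proof (intro conjI ballI allI impI)
  fix s t u v :: real
  assume *: "s \<in> {0..}" "t \<in> {0..}" "0 \<le> u" "0 \<le> v" "u + v = 1"
  let ?F = "\<lambda>t. INF i\<in>I. a i + g i * t"
  show "u * ?F s + v * ?F t \<le> ?F (u *\<^sub>R s + v *\<^sub>R t)"
  proof (rule cINF_greatest[OF \<open>I \<noteq> {}\<close>])
    fix i assume "i \<in> I"
    have le: "?F r \<le> a i + g i * r" if "0 \<le> r" for r
      by (rule cINF_lower[OF bdd_below_affine \<open>i \<in> I\<close>]) (use assms that in auto)
    have "u * ?F s + v * ?F t \<le> u * (a i + g i * s) + v * (a i + g i * t)"
      using * by (intro add_mono mult_left_mono le) auto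
    also have "\<dots> = (u + v) * a i + g i * (u *\<^sub>R s + v *\<^sub>R t)"
      by (simp add: algebra_simps)
    finally show "u * ?F s + v * ?F t \<le> a i + g i * (u *\<^sub>R s + v *\<^sub>R t)"
      using \<open>u + v = 1\<close> by simp
  qed
qed simp

text \<open>Every member rises by at least \<open>\<delta> * (t - s)\<close>, a bound uniform in
  \<open>i\<close> that survives the infimum. Strict monotonicity of the members alone would
  not.\<close>

lemma INF_affine_growth:
  fixes a g :: "'i \<Rightarrow> real"
  assumes "I \<noteq> {}" "\<And>i. i \<in> I \<Longrightarrow> 0 \<le> a i" "\<And>i. i \<in> I \<Longrightarrow> \<delta> \<le> g i" "0 \<le> \<delta>"
    and "0 \<le> s" "s \<le> t"
  shows "(INF i\<in>I. a i + g i * s) + \<delta> * (t - s) \<le> (INF i\<in>I. a i + g i * t)"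
proof (rule cINF_greatest[OF \<open>I \<noteq> {}\<close>])
  fix i assume i: "i \<in> I"
  have "0 \<le> g j" if "j \<in> I" for j
    using assms(3)[OF that] \<open>0 \<le> \<delta>\<close> by simp
  then have "(INF i\<in>I. a i + g i * s) \<le> a i + g i * s"
    by (intro cINF_lower[OF bdd_below_affine i]) (use assms in auto)
  moreover have "\<delta> * (t - s) \<le> g i * (t - s)"
    by (rule mult_right_mono) (use assms i in auto)
  ultimately show "(INF i\<in>I. a i + g i * s) + \<delta> * (t - s) \<le> a i + g i * t"
    by (simp add: algebra_simps)
qed

text \<open>The uniform slope bound gives strict growth, and arbitrarily small intercepts force the
  value 0 at 0. Continuity is split: concavity yields it on the open half-line, but would allow a
  jump at the endpoint, which needs a squeeze.\<close>

lemma index_function_INF_affine: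
  fixes a g :: "'i \<Rightarrow> real"
  assumes "I \<noteq> {}" and a: "\<And>i. i \<in> I \<Longrightarrow> 0 \<le> a i"
    and g: "\<And>i. i \<in> I \<Longrightarrow> \<delta> \<le> g i" "0 < \<delta>"
    and small: "\<And>\<epsilon>. 0 < \<epsilon> \<Longrightarrow> \<exists>i\<in>I. a i < \<epsilon>"
  shows "index_function (\<lambda>t. INF i\<in>I. a i + g i * t)" (is "index_function ?F")
proof -
  have g0: "0 \<le> g i" if "i \<in> I" for i
    using g(1)[OF that] g(2) by simp
  have le: "?F t \<le> a i + g i * t" if "i \<in> I" "0 \<le> t" for i t
    by (rule cINF_lower[OF bdd_below_affine]) (use a g0 that in auto)
  have nonneg: "0 \<le> ?F t" if "0 \<le> t" for t
    by (rule cINF_greatest[OF \<open>I \<noteq> {}\<close>]) (use a g0 that in auto)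
  have zero: "?F 0 = 0"
  proof (rule antisym[OF field_le_epsilon nonneg])
    fix \<epsilon> :: real assume "0 < \<epsilon>"
    then obtain i where "i \<in> I" "a i < \<epsilon>" using small by blast
    then show "?F 0 \<le> 0 + \<epsilon>" using le[of i 0] by simp
  qed simp
  have grow: "?F s < ?F t" if "0 \<le> s" "s < t" for s t
  proof -
    have "?F s + \<delta> * (t - s) \<le> ?F t"
      using INF_affine_growth[of I a \<delta> g s t] assms(1) a g that by simp
    moreover have "0 < \<delta> * (t - s)" using g(2) that by simp
    ultimately show ?thesis by linarith
  qed
  have cont_pos: "continuous_on {0<..} ?F"
  proof -
    have "concave_on {0<..} ?F"
      using concave_on_INF_affine[OF \<open>I \<noteq> {}\<close> a g0]
      unfolding concave_on_def by (rule convex_on_subset) auto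
    then have "continuous_on {0<..} (\<lambda>t. - ?F t)"
      unfolding concave_on_def by (intro convex_on_continuous) auto
    then show ?thesis
      using continuous_on_minus by fastforce
  qed
  have cont_zero: "(?F \<longlongrightarrow> ?F 0) (at 0 within {0..})"
    unfolding zero
  proof (rule tendstoI)
    fix \<epsilon> :: real assume "0 < \<epsilon>"
    \<comment> \<open>This one member lies above the infimum and stays below
      \<open>\<epsilon>\<close> near 0.\<close>
    then obtain i where i: "i \<in> I" "a i < \<epsilon>" using small by blast
    have "((\<lambda>t. a i + g i * t) \<longlongrightarrow> a i + g i * 0) (at 0 within {0..})"
      by (intro tendsto_intros)
    then have "\<forall>\<^sub>F t in at 0 within {0..}. a i + g i * t < \<epsilon>"
      using i(2) by (intro order_tendstoD(2)) auto
    moreover have "\<forall>\<^sub>F t :: real in at 0 within {0..}. t \<in> {0..}"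
      by (simp add: eventually_at_filter)
    ultimately show "\<forall>\<^sub>F t in at 0 within {0..}. dist (?F t) 0 < \<epsilon>"
    proof eventually_elim
      case (elim t)
      then show ?case using le[OF i(1), of t] nonneg[of t] by simp
    qed
  qed
  have "continuous_on {0..} ?F"
    unfolding continuous_on_def
  proof
    fix t :: real assume "t \<in> {0..}"
    then consider "t = 0" | "0 < t" by fastforce
    then show "(?F \<longlongrightarrow> ?F t) (at t within {0..})"
    proof cases
      case 1
      then show ?thesis using cont_zero by simp
    next
      case 2
      then have "isCont ?F t"
        using cont_pos by (simp add: continuous_on_eq_continuous_at)
      then show ?thesis
        unfolding isCont_def by (rule tendsto_within_subset) simp
    qed
  qed
  then show ?thesis
    unfolding index_function_def strict_mono_on_def using nonneg grow zero by auto
qed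

text \<open>The minimum over \<open>{1..k}\<close> is positive, being finite. It also bounds the
  later values, since they exceed \<open>\<gamma> k\<close> by the gap condition.\<close>

lemma positive_lower_bound:
  fixes \<gamma> :: "nat \<Rightarrow> real"
  assumes pos: "\<And>n. n \<ge> 1 \<Longrightarrow> \<gamma> n > 0"
    and "k \<ge> 1" and k: "\<gamma> k < (INF l\<in>{k<..}. \<gamma> l)"
  obtains \<delta> where "0 < \<delta>" "\<And>n. n \<ge> 1 \<Longrightarrow> \<delta> \<le> \<gamma> n"
proof
  show "0 < Min (\<gamma> ` {1..k})"
    using assms by (subst Min_gr_iff) auto
  fix n :: nat assume "n \<ge> 1"
  show "Min (\<gamma> ` {1..k}) \<le> \<gamma> n"
  proof (cases "n \<le> k")
    case True
    then show ?thesis using \<open>n \<ge> 1\<close> by simp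
  next
    case False
    have "bdd_below (\<gamma> ` {k<..})"
      by (rule bdd_belowI2[of _ 0]) (use pos in \<open>simp add: less_imp_le\<close>)
    then have "(INF l\<in>{k<..}. \<gamma> l) \<le> \<gamma> n"
      using False by (intro cINF_lower) auto
    moreover have "Min (\<gamma> ` {1..k}) \<le> \<gamma> k"
      using \<open>k \<ge> 1\<close> by simp
    ultimately show ?thesis using k by simp
  qed
qed

section \<open>Splitting sequences along an index set\<close>

lemma norm_proj_l1_split: "norm x = norm (proj_l1 M x) + norm (x - proj_l1 M x)"
proof -
  have "norm (proj_l1 M x) + norm (x - proj_l1 M x)
      = (\<Sum>k. \<bar>l1_nth (proj_l1 M x) k\<bar> + \<bar>l1_nth (x - proj_l1 M x) k\<bar>)"
    by (simp add: norm_l1.rep_eq suminf_add summable_l1_abs)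
  also have "\<dots> = norm x"
    unfolding norm_l1.rep_eq
    by (rule suminf_cong) (simp add: minus_l1.rep_eq proj_l1.rep_eq)
  finally show ?thesis ..
qed

lemma proj_l1_diff: "proj_l1 M (x - y) = proj_l1 M x - proj_l1 M y"
  by (rule l1_eqI) (simp add: proj_l1.rep_eq minus_l1.rep_eq)

text \<open>The projections onto initial segments are the partial sums of the unit vector
  expansion.\<close>

lemma tendsto_proj_l1_lessThan: "(\<lambda>n. norm (x - proj_l1 {..<n} x)) \<longlonglongrightarrow> 0"
proof -
  have nth: "l1_nth (\<Sum>k<n. l1_nth x k *\<^sub>R unit_l1 k) j = (if j < n then l1_nth x j else 0)" for n j
    by (induction n) (auto simp: zero_l1.rep_eq plus_l1.rep_eq scaleR_l1.rep_eq unit_l1.rep_eq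
        less_Suc_eq)
  have "proj_l1 {..<n} x = (\<Sum>k<n. l1_nth x k *\<^sub>R unit_l1 k)" for n
    by (rule l1_eqI) (simp add: nth proj_l1.rep_eq)
  then have "(\<lambda>n. proj_l1 {..<n} x) \<longlonglongrightarrow> x"
    using l1_sums_unit[of x] by (simp add: sums_def)
  then have "(\<lambda>n. norm (x - proj_l1 {..<n} x)) \<longlonglongrightarrow> norm (x - x)"
    by (intro tendsto_intros)
  then show ?thesis by simp
qed

lemma norm_proj_l1_le_source:
  fixes A :: "l1 \<Rightarrow>\<^sub>L 'y::real_normed_vector"
  assumes "source_assumption A \<M> \<gamma> c" "n \<ge> 1" "M \<in> \<M> n"
  shows "norm (proj_l1 M h) \<le> c * norm (h - proj_l1 M h) + \<gamma> n * norm (A h)"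
proof -
  \<comment> \<open>With these signs, pairing with \<open>h\<close> recovers the absolute values on
    \<open>M\<close>.\<close>
  define \<xi> :: linf where "\<xi> = Bcontfun (\<lambda>k. if k \<in> M then sgn (l1_nth h k) else 0)"
  have "(\<lambda>k. if k \<in> M then sgn (l1_nth h k) else 0) \<in> bcontfun"
    unfolding bcontfun_nat_iff bounded_iff by (rule exI[of _ 1]) (auto simp: sgn_if)
  then have \<xi>: "apply_bcontfun \<xi> k = (if k \<in> M then sgn (l1_nth h k) else 0)" for k
    unfolding \<xi>_def by (simp add: Bcontfun_inverse)
  have supp: "supp \<xi> = {k \<in> M. l1_nth h k \<noteq> 0}"
    by (auto simp: supp_def \<xi> sgn_eq_0_iff split: if_splits)
  have "\<xi> \<in> sign_seqs M"
    by (auto simp: sign_seqs_def supp \<xi> sgn_if)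
  then obtain \<eta> :: "'y \<Rightarrow>\<^sub>L real" where \<eta>: "norm \<eta> \<le> \<gamma> n"
    and on: "proj_linf (supp \<xi>) (adjoint_l1 A \<eta>) = \<xi>"
    and off: "norm (adjoint_l1 A \<eta> - proj_linf (supp \<xi>) (adjoint_l1 A \<eta>)) \<le> c"
    using assms unfolding source_assumption_def by blast
  define \<zeta> where "\<zeta> = adjoint_l1 A \<eta>"
  \<comment> \<open>The support of \<open>\<xi>\<close> may be smaller than \<open>M\<close>; at the
    missing indices \<open>h\<close> vanishes, so they contribute nothing to the pairing.\<close>
  have \<zeta>_on: "apply_bcontfun \<zeta> k = sgn (l1_nth h k)" if "k \<in> M" "l1_nth h k \<noteq> 0" for k
    using on apply_proj_linf[of "supp \<xi>" \<zeta> k] that by (simp add: \<zeta>_def supp \<xi>)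
  have \<zeta>_off: "\<bar>apply_bcontfun \<zeta> k\<bar> \<le> c" if "k \<notin> M" for k
    using norm_bounded[of "\<zeta> - proj_linf (supp \<xi>) \<zeta>" k] off that
    by (simp add: \<zeta>_def supp apply_proj_linf)
  have termwise: "\<bar>l1_nth (proj_l1 M h) k\<bar> - c * \<bar>l1_nth (h - proj_l1 M h) k\<bar>
      \<le> apply_bcontfun \<zeta> k * l1_nth h k" for k
  proof (cases "k \<in> M")
    case True
    then show ?thesis
      using \<zeta>_on[of k]
      by (cases "l1_nth h k = 0") (auto simp: proj_l1.rep_eq minus_l1.rep_eq abs_sgn mult.commute)
  next
    case False
    have "\<bar>apply_bcontfun \<zeta> k * l1_nth h k\<bar> \<le> c * \<bar>l1_nth h k\<bar>"
      using \<zeta>_off[OF False] by (simp add: abs_mult mult_right_mono)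
    then show ?thesis
      using False by (simp add: proj_l1.rep_eq minus_l1.rep_eq)
  qed
  have "norm (proj_l1 M h) - c * norm (h - proj_l1 M h)
      = (\<Sum>k. \<bar>l1_nth (proj_l1 M h) k\<bar> - c * \<bar>l1_nth (h - proj_l1 M h) k\<bar>)"
    by (simp add: norm_l1.rep_eq suminf_diff[symmetric] suminf_mult summable_mult summable_l1_abs)
  also have "\<dots> \<le> (\<Sum>k. apply_bcontfun \<zeta> k * l1_nth h k)"
    by (intro suminf_le termwise summable_l1_pairing summable_diff summable_mult summable_l1_abs)
  also have "\<dots> = \<eta> (A h)"
    unfolding linf_dual_apply[symmetric] \<zeta>_def linf_dual_adjoint_l1 by simp
  also have "\<dots> \<le> norm \<eta> * norm (A h)"
    using norm_blinfun[of \<eta> "A h"] by simp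
  also have "\<dots> \<le> \<gamma> n * norm (A h)"
    using \<eta> by (rule mult_right_mono) simp
  finally show ?thesis by simp
qed

lemma variational_inequality_index_set:
  fixes A :: "l1 \<Rightarrow>\<^sub>L 'y::real_normed_vector"
  assumes "source_assumption A \<M> \<gamma> c" "n \<ge> 1" "M \<in> \<M> n" "0 \<le> c"
  shows "(1 - c) / (1 + c) * norm (x - x\<^sub>0) \<le> norm x - norm x\<^sub>0
    + 2 * (norm (x\<^sub>0 - proj_l1 M x\<^sub>0) + 1 / (1 + c) * \<gamma> n * norm (A x - A x\<^sub>0))"
proof -
  define p where "p = norm (proj_l1 M (x - x\<^sub>0))"
  define q where "q = norm ((x - x\<^sub>0) - proj_l1 M (x - x\<^sub>0))"
  define r where "r = \<gamma> n * norm (A x - A x\<^sub>0)"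
  define z where "z = norm (x\<^sub>0 - proj_l1 M x\<^sub>0)"
  have "p \<le> c * q + r"
    using norm_proj_l1_le_source[OF assms(1-3), of "x - x\<^sub>0"]
    by (simp add: p_def q_def r_def blinfun.diff_right)
  \<comment> \<open>Twice the previous bound, rearranged so that \<open>p + q\<close>, the norm of
    \<open>x - x\<^sub>0\<close>, stands on the left. Dividing by \<open>1 + c\<close> produces the
    constant of the theorem.\<close>
  then have "(1 - c) * (p + q) \<le> (1 + c) * (q - p) + 2 * r"
    by (simp add: algebra_simps)
  then have "(1 - c) * (p + q) / (1 + c) \<le> ((1 + c) * (q - p) + 2 * r) / (1 + c)"
    using \<open>0 \<le> c\<close> by (intro divide_right_mono) auto
  also have "\<dots> = q - p + 2 * (r / (1 + c))"
    using \<open>0 \<le> c\<close> by (simp add: add_divide_distrib)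
  finally have 1: "(1 - c) / (1 + c) * norm (x - x\<^sub>0) \<le> q - p + 2 * (r / (1 + c))"
    using norm_proj_l1_split[of "x - x\<^sub>0" M] by (simp add: p_def q_def)
  have "norm (proj_l1 M x\<^sub>0) \<le> norm (proj_l1 M x) + p"
    using norm_triangle_sub[of "proj_l1 M x\<^sub>0" "proj_l1 M x"]
    by (simp add: p_def proj_l1_diff norm_minus_commute)
  moreover have "q \<le> norm (x - proj_l1 M x) + z"
    using norm_triangle_ineq4[of "x - proj_l1 M x" "x\<^sub>0 - proj_l1 M x\<^sub>0"]
    by (simp add: q_def z_def proj_l1_diff algebra_simps)
  \<comment> \<open>One \<open>z\<close> comes from the triangle inequality off \<open>M\<close>,
    the other from the part of the norm of \<open>x\<^sub>0\<close> off \<open>M\<close>.\<close>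
  ultimately have "q - p - 2 * z \<le> norm x - norm x\<^sub>0"
    using norm_proj_l1_split[of x M] norm_proj_l1_split[of x\<^sub>0 M] by (simp add: z_def)
  then have "q - p + 2 * (r / (1 + c)) \<le> norm x - norm x\<^sub>0 + 2 * (z + r / (1 + c))"
    by simp
  from order_trans[OF 1 this] show ?thesis by (simp add: z_def r_def)
qed

section \<open>The rate function\<close>

theorem theorem2p2:
  fixes A :: "l1 \<Rightarrow>\<^sub>L 'y::banach"
    and x\<^sub>0 :: l1
    and \<M> :: "nat \<Rightarrow> nat set set"
    and \<gamma> :: "nat \<Rightarrow> real"
    and c :: real
  assumes "inj (blinfun_apply A)"
    and "\<And>n. n \<ge> 1 \<Longrightarrow> \<gamma> n > 0"
    and "0 \<le> c" and "c < 1"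
    and "source_assumption A \<M> \<gamma> c"
    and "\<exists>k\<ge>1. \<gamma> k < (INF l\<in>{k<..}. \<gamma> l)"
  shows "index_function (rate_function \<M> \<gamma> c x\<^sub>0) \<and>
    concave_on {0..} (rate_function \<M> \<gamma> c x\<^sub>0) \<and>
    (\<forall>x. (1 - c) / (1 + c) * norm (x - x\<^sub>0)
       \<le> norm x - norm x\<^sub>0
         + rate_function \<M> \<gamma> c x\<^sub>0 (norm (blinfun_apply A x - blinfun_apply A x\<^sub>0)))"
proof (intro conjI allI)
  define a where "a n = (INF M\<in>\<M> n. norm (x\<^sub>0 - proj_l1 M x\<^sub>0))" for n
  define g where "g n = 1 / (1 + c) * \<gamma> n" for n
  define F where "F t = (INF n\<in>{1..}. a n + g n * t)" for t
  have rate: "rate_function \<M> \<gamma> c x\<^sub>0 = (\<lambda>t. 2 * F t)"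
    by (simp add: fun_eq_iff rate_function_def F_def a_def g_def)
  have initial: "{..<n} \<in> \<M> n" if "n \<ge> 1" for n
    using assms(5) that unfolding source_assumption_def by blast
  then have ne: "\<M> n \<noteq> {}" if "n \<ge> 1" for n
    using that by blast
  have a_nonneg: "0 \<le> a n" if "n \<in> {1..}" for n
    unfolding a_def by (rule cINF_greatest) (use ne that in auto)
  have a_small: "\<exists>n\<in>{1..}. a n < \<epsilon>" if "0 < \<epsilon>" for \<epsilon>
  proof -
    have "\<forall>\<^sub>F n in sequentially. norm (x\<^sub>0 - proj_l1 {..<n} x\<^sub>0) < \<epsilon> \<and> n \<ge> 1"
      using order_tendstoD(2)[OF tendsto_proj_l1_lessThan that] eventually_ge_at_top
      by (rule eventually_conj)
    then obtain n where n: "norm (x\<^sub>0 - proj_l1 {..<n} x\<^sub>0) < \<epsilon>" "n \<ge> 1"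
      using eventually_happens' sequentially_bot by blast
    \<comment> \<open>The initial segment belongs to the family, so it competes in the infimum
      defining \<open>a n\<close>.\<close>
    have "a n \<le> norm (x\<^sub>0 - proj_l1 {..<n} x\<^sub>0)"
      unfolding a_def by (intro cINF_lower bdd_belowI2[of _ 0] initial n(2)) simp
    then show ?thesis using n by force
  qed
  obtain \<delta> where \<delta>: "0 < \<delta>" "\<And>n. n \<ge> 1 \<Longrightarrow> \<delta> \<le> \<gamma> n"
    using assms(2,6) positive_lower_bound by metis
  have g: "\<delta> / (1 + c) \<le> g n" if "n \<in> {1..}" for n
    using \<delta>(2)[of n] that \<open>0 \<le> c\<close> by (simp add: g_def divide_right_mono)
  have "0 < \<delta> / (1 + c)" using \<delta>(1) \<open>0 \<le> c\<close> by simp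
  have "index_function F"
    unfolding F_def
    by (rule index_function_INF_affine[OF _ a_nonneg g \<open>0 < \<delta> / (1 + c)\<close> a_small]) auto
  then show "index_function (rate_function \<M> \<gamma> c x\<^sub>0)"
    unfolding rate index_function_def
    by (auto intro!: continuous_intros simp: strict_mono_on_def)
  have "0 \<le> g n" if "n \<in> {1..}" for n
    using g[OF that] \<open>0 < \<delta> / (1 + c)\<close> by simp
  then have "concave_on {0..} F"
    unfolding F_def by (intro concave_on_INF_affine a_nonneg) auto
  then show "concave_on {0..} (rate_function \<M> \<gamma> c x\<^sub>0)"
    unfolding rate by (intro concave_on_cmul) auto
  fix x
  \<comment> \<open>The desired inequality solved for \<open>F\<close>. It suffices that
    \<open>?d\<close> is a lower bound of the outer infimum; moving the slope term to the left then
    isolates the inner one.\<close>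
  let ?d = "((1 - c) / (1 + c) * norm (x - x\<^sub>0) - (norm x - norm x\<^sub>0)) / 2"
  have "?d \<le> F (norm (A x - A x\<^sub>0))"
    unfolding F_def
  proof (rule cINF_greatest)
    fix n :: nat assume n: "n \<in> {1..}"
    have "?d - g n * norm (A x - A x\<^sub>0) \<le> a n"
      unfolding a_def
    proof (rule cINF_greatest)
      fix M assume "M \<in> \<M> n"
      from variational_inequality_index_set[OF assms(5) _ this \<open>0 \<le> c\<close>, of x x\<^sub>0] n
      show "?d - g n * norm (A x - A x\<^sub>0) \<le> norm (x\<^sub>0 - proj_l1 M x\<^sub>0)"
        by (simp add: g_def field_simps)
    qed (use ne n in simp)
    then show "?d \<le> a n + g n * norm (A x - A x\<^sub>0)"
      by (simp only: diff_le_eq)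
  qed simp
  then show "(1 - c) / (1 + c) * norm (x - x\<^sub>0)
      \<le> norm x - norm x\<^sub>0 + rate_function \<M> \<gamma> c x\<^sub>0 (norm (A x - A x\<^sub>0))"
    unfolding rate by (simp add: field_simps)
qed

end
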